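(* For every integer $n \geq 1$ the following holds. \begin{enumerate} \item The graph $K_{2,n-1}$ is $(n;2,2)$-subspace choosable over every field $\mathbb{F}$. \item The graph $K_{2,n}$ is $(n;2,2)$-subspace choosable over $\mathbb{C}$. \item The graph $K_{2,n}$ is $(n;2,2)$-subspace choosable over $\mathbb{R}$ if and only if $n$ is odd. \end{enumerate}
   Context: Inner product: on $\mathbb{C}^t$, $\langle x,y\rangle=\sum_i x_i\overline{y_i}$; on $\mathbb{F}^t$ for every other field $\mathbb{F}$ (in particular $\mathbb{R}$ and finite fields), $\langle x,y\rangle=\sum_i x_iy_i$. For a finite simple graph $G=(V,E)$ and a function $f$ from $V$ to the positive integers, $G$ is $f$-subspace choosable over a field $\mathbb{F}$ if for every integer $t$ and every assignment of subspaces $W_v\subseteq\mathbb{F}^t$ with $\dim(W_v)=f(v)$ to the vertices $v\in V$, there exists a choice of a nonzero vector $x_v\in W_v$ for each $v\in V$ such that $\langle x_v,x_{v'}\rangle=0$ whenever $v$ and $v'$ are adjacent in $G$. $K_{2,m}$ is the complete bipartite graph with two vertices $u_1,u_2$ on the left side and $m$ vertices on the right side. For an integer $n$, $K_{2,m}$ is $(n;2,2)$-subspace choosable over $\mathbb{F}$ if it is $f$-subspace choosable over $\mathbb{F}$ for the function $f$ with $f(u_1)=n$, $f(u_2)=2$, and $f(v)=2$ for every right vertex $v$. *)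

theory Defs
  imports
    "Jordan_Normal_Form.VS_Connect"
    "Jordan_Normal_Form.Conjugate"
    "Graph_Theory.Pair_Digraph"
    "Graph_Theory.Kuratowski"
begin

text \<open>
  Undirected finite simple graphs are the \<open>pair_graph\<close>s of the AFP entry \<open>Graph_Theory\<close>: an edge
  is a pair of opposite arcs, and there are no loops.

  The inner product depends on the field, so it is a parameter \<open>ip\<close> below: it is
  \<open>scalar_prod\<close> (the sum of \<open>x i * y i\<close>) over a general field, and \<open>cscalar_prod\<close>
  (the sum of \<open>x i * cnj (y i)\<close>) over the complex numbers.
  The field itself is the type \<open>'a\<close>, and its \<open>t\<close>-dimensional coordinate space is
  \<open>module_vec TYPE('a) t\<close>.
\<close>

definition subspace_choosable ::
    "('a::field vec \<Rightarrow> 'a vec \<Rightarrow> 'a) \<Rightarrow> 'v pair_pre_digraph \<Rightarrow> ('v \<Rightarrow> nat) \<Rightarrow> bool" where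
  "subspace_choosable ip G f \<longleftrightarrow>
     (\<forall>(t::nat) (W :: 'v \<Rightarrow> 'a vec set).
        (\<forall>v \<in> pverts G.
            VectorSpace.subspace class_ring (W v) (module_vec TYPE('a) t) \<and>
            vectorspace.dim class_ring ((module_vec TYPE('a) t)\<lparr>carrier := W v\<rparr>) = f v)
        \<longrightarrow> (\<exists>x :: 'v \<Rightarrow> 'a vec.
              (\<forall>v \<in> pverts G. x v \<in> W v \<and> x v \<noteq> 0\<^sub>v t) \<and>
              (\<forall>v v'. (v, v') \<in> parcs G \<longrightarrow> ip (x v) (x v') = 0)))"

text \<open>The left vertices are \<open>Inl 0\<close> and \<open>Inl 1\<close>; the right vertices are \<open>Inr j\<close> for \<open>j < m\<close>.\<close>

definition K2 :: "nat \<Rightarrow> (nat + nat) pair_pre_digraph" where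
  "K2 m = (let L = Inl ` {..<2}; R = Inr ` {..<m}
           in \<lparr> pverts = L \<union> R, parcs = L \<times> R \<union> R \<times> L \<rparr>)"

lemma K2_complete_bipartite: "complete_bipartite_digraph 2 m (with_proj (K2 m))"
proof -
  have "finite (pverts (K2 m))"
    by (simp add: K2_def Let_def)
  moreover have "\<exists>U V. pverts (K2 m) = U \<union> V \<and> U \<inter> V = {} \<and> card U = 2 \<and> card V = m \<and>
      parcs (K2 m) = U \<times> V \<union> V \<times> U"
    by (rule exI[of _ "Inl ` {..<2}"], rule exI[of _ "Inr ` {..<m}"])
      (auto simp: K2_def Let_def card_image)
  ultimately show ?thesis
    unfolding complete_bipartite_digraph_pair_def by blast
qed

lemma K2_pair_graph: "pair_graph (K2 m)"
  using K2_complete_bipartite by (rule pair_graphI_complete_bipartite)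

definition K2_dims :: "nat \<Rightarrow> nat + nat \<Rightarrow> nat" where
  "K2_dims n v = (if v = Inl 0 then n else 2)"

text \<open>\<open>K2_choosable ip m n\<close>: the complete bipartite graph with parts of sizes \<open>2\<close> and \<open>m\<close> is
  \<open>(n;2,2)\<close>-subspace choosable.\<close>

definition K2_choosable :: "('a::field vec \<Rightarrow> 'a vec \<Rightarrow> 'a) \<Rightarrow> nat \<Rightarrow> nat \<Rightarrow> bool" where
  "K2_choosable ip m n \<longleftrightarrow> subspace_choosable ip (K2 m) (K2_dims n)"

end

theory Submission
  imports Defs "Jordan_Normal_Form.DL_Rank" "Jordan_Normal_Form.Char_Poly"
    "HOL-Computational_Algebra.Fundamental_Theorem_Algebra"
begin

text \<open>
  Let \<open>X\<close> and \<open>Y\<close> be the spaces of the two left vertices, with \<open>dim X = n\<close> and \<open>dim Y = 2\<close>, and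
  let \<open>a j\<close>, \<open>b j\<close> be a basis of the space of the right vertex \<open>j\<close>. Once \<open>x \<in> X\<close> and \<open>y \<in> Y\<close> are
  chosen, the right vertex \<open>j\<close> has a nonzero vector orthogonal to both of them if and only if the
  two by two matrix with rows \<open>(\<langle>x, a j\<rangle>, \<langle>x, b j\<rangle>)\<close> and \<open>(\<langle>y, a j\<rangle>, \<langle>y, b j\<rangle>)\<close> is singular. Its
  determinant is bilinear in \<open>x\<close> and \<open>y\<close>. In coordinates for \<open>X\<close> and \<open>Y\<close>, the \<open>m\<close> determinants
  together form the vector \<open>(s A - r B) v\<close>, where \<open>v\<close> gives \<open>x\<close>, the pair \<open>(s, r)\<close> gives \<open>y\<close>, and
  \<open>A\<close>, \<open>B\<close> are \<open>m\<close> by \<open>n\<close> matrices. So it suffices to find a nonzero \<open>(s, r)\<close> for which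
  \<open>s A - r B\<close> has a nontrivial kernel.

  Conversely, every pair \<open>A\<close>, \<open>B\<close> arises in this way: in dimension \<open>n + 2\<close> take the first \<open>n\<close>
  coordinates for \<open>X\<close>, the last two for \<open>Y\<close>, and let row \<open>j\<close> of the two matrices prescribe the
  \<open>X\<close>-parts of \<open>a j\<close> and \<open>b j\<close>. Hence the graph is choosable if and only if every
  \<open>m\<close> by \<open>n\<close> pencil has a member with a nontrivial kernel
  (\<open>K2_choosable_iff_degenerate_pencils\<close>). The argument covers the bilinear and the Hermitian
  product at once, as both have the form \<open>\<langle>x, y\<rangle> = \<Sum> x i * \<sigma> (y i)\<close> for an involution \<open>\<sigma>\<close> of the
  field.

  What remains is linear algebra. For \<open>m < n\<close> every matrix has a nontrivial kernel. For \<open>m = n\<close>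
  and \<open>A\<close> invertible, a singular member of the pencil is an eigenvalue of the product of the inverse
  of \<open>A\<close> with \<open>B\<close>, that is, a root of a monic polynomial of degree \<open>n\<close>; it exists over the complex numbers,
  and over the reals if \<open>n\<close> is odd. If \<open>n\<close> is even, there is a real matrix \<open>J\<close> whose square is minus
  the identity; it has no real eigenvalue, so the pencil of the identity and \<open>J\<close> has no singular
  member except the zero matrix at \<open>s = r = 0\<close>.
\<close>

section \<open>Subspaces as ranges of injective matrices\<close>

definition subspace_of_dim :: "'a::field vec set \<Rightarrow> nat \<Rightarrow> nat \<Rightarrow> bool" where
  "subspace_of_dim W t k \<longleftrightarrow>
     VectorSpace.subspace class_ring W (module_vec TYPE('a) t) \<and>
     vectorspace.dim class_ring ((module_vec TYPE('a) t)\<lparr>carrier := W\<rparr>) = k"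

definition inj_mat :: "'a::field mat \<Rightarrow> nat \<Rightarrow> nat \<Rightarrow> bool" where
  "inj_mat B t k \<longleftrightarrow> B \<in> carrier_mat t k \<and>
     (\<forall>c \<in> carrier_vec k. B *\<^sub>v c = 0\<^sub>v t \<longrightarrow> c = 0\<^sub>v k)"

lemma mult_mat_unit_vec:
  fixes B :: "'a::semiring_1 mat"
  assumes "B \<in> carrier_mat t k" "i < k"
  shows "B *\<^sub>v unit_vec k i = col B i"
  using assms by (intro eq_vecI) auto

lemma inj_mat_distinct_cols:
  assumes "inj_mat B t k"
  shows "distinct (cols B)"
proof -
  have B: "B \<in> carrier_mat t k" using assms by (simp add: inj_mat_def)
  have "col B i \<noteq> col B j" if i: "i < k" and j: "j < k" and ij: "i \<noteq> j" for i j
  proof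
    assume eq: "col B i = col B j"
    have "B *\<^sub>v (unit_vec k i - unit_vec k j) = B *\<^sub>v unit_vec k i - B *\<^sub>v unit_vec k j"
      by (rule mult_minus_distrib_mat_vec[OF B]) auto
    also have "\<dots> = col B i - col B j"
      using mult_mat_unit_vec[OF B i] mult_mat_unit_vec[OF B j] by simp
    also have "\<dots> = 0\<^sub>v t" using eq B by auto
    finally have "unit_vec k i - unit_vec k j = (0\<^sub>v k :: 'a vec)"
      using assms by (auto simp: inj_mat_def)
    then have "(unit_vec k i - unit_vec k j) $ i = (0\<^sub>v k :: 'a vec) $ i" by simp
    with i j ij show False by simp
  qed
  then show ?thesis using B by (auto simp: distinct_conv_nth)
qed

text \<open>
  The columns of an injective matrix form a basis of its range. This is how the subspaces that witness
  non-choosability are built.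
\<close>

lemma subspace_of_dim_range:
  assumes "inj_mat B t k"
  shows "subspace_of_dim ((\<lambda>c. B *\<^sub>v c) ` carrier_vec k) t k"
proof -
  interpret vec_space "TYPE('a)" t .
  have B: "B \<in> carrier_mat t k" and inj: "\<And>c. c \<in> carrier_vec k \<Longrightarrow> B *\<^sub>v c = 0\<^sub>v t \<Longrightarrow> c = 0\<^sub>v k"
    using assms by (auto simp: inj_mat_def)
  have d: "distinct (cols B)" using assms by (rule inj_mat_distinct_cols)
  have S: "set (cols B) \<subseteq> carrier_vec t" using cols_dim B by blast
  have "lin_indpt (set (cols B))"
    using lin_depE[OF B _ d] inj by metis
  then have "rank B = k" using lin_indpt_full_rank[OF B d] by simp
  moreover have "span (set (cols B)) = (\<lambda>c. B *\<^sub>v c) ` carrier_vec k"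
    using col_space_eq[OF B] B unfolding col_space_def by (auto simp: image_iff)
  ultimately show ?thesis
    unfolding subspace_of_dim_def rank_def
    using span_is_subspace[of "set (cols B)"] S by simp
qed

text \<open>
  Coordinates on a given subspace: the columns of \<open>B\<close> are a basis of \<open>W\<close>.
\<close>

lemma range_if_subspace_of_dim:
  fixes W :: "'a::field vec set"
  assumes "subspace_of_dim W t k"
  obtains B where "inj_mat B t k" "W = (\<lambda>c. B *\<^sub>v c) ` carrier_vec k"
proof -
  interpret vec_space "TYPE('a)" t .
  have sub: "VectorSpace.subspace class_ring W V" and dim: "vectorspace.dim class_ring (vs W) = k"
    using assms by (auto simp: subspace_of_dim_def)
  have sm: "submodule class_ring W V" using sub by (simp add: VectorSpace.subspace_def)
  have W: "W \<subseteq> carrier_vec t" using sm unfolding submodule_def by simp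
  interpret W: vectorspace class_ring "vs W" using subspace_is_vs[OF sub] .
  \<comment> \<open>The dimension is the least size of a finite generating set, so it says something about bases only
    after a finite basis of \<open>W\<close> is found. A maximal independent subset is one, because independent
    subsets of \<open>W\<close> have at most \<open>t\<close> elements.\<close>
  have "finite S \<and> card S \<le> t" if "S \<subseteq> carrier (vs W) \<and> W.lin_indpt S" for S
  proof -
    have "S \<subseteq> W" "lin_indpt S" using that span_li_not_depend(2)[OF _ sm] by auto
    then show ?thesis using li_le_dim[of S] W dim_is_n by auto
  qed
  moreover have "{} \<subseteq> carrier (vs W) \<and> W.lin_indpt {}" by (simp add: W.lin_dep_def)
  ultimately obtain \<beta> where fin: "finite \<beta>"
    and "maximal \<beta> (\<lambda>S. S \<subseteq> carrier (vs W) \<and> W.lin_indpt S)"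
    using maximal_exists[of "\<lambda>S. S \<subseteq> carrier (vs W) \<and> W.lin_indpt S" t "{}"] by blast
  then have basis: "W.basis \<beta>" using W.max_li_is_basis by blast
  have card: "card \<beta> = k" using W.dim_basis[OF fin basis] dim by simp
  have \<beta>W: "\<beta> \<subseteq> W" using basis by (simp add: W.basis_def)
  have li: "lin_indpt \<beta>" and sp: "span \<beta> = W"
    using basis span_li_not_depend[OF \<beta>W sm] by (auto simp: W.basis_def)
  obtain bs where bs: "set bs = \<beta>" "distinct bs" using finite_distinct_list[OF fin] by blast
  define B where "B = mat_of_cols t bs"
  have len: "length bs = k" using bs card distinct_card by fastforce
  have B: "B \<in> carrier_mat t k" using mat_of_cols_carrier(1)[of t bs] by (simp add: B_def len)
  have cols: "cols B = bs" unfolding B_def by (rule cols_mat_of_cols) (use bs \<beta>W W in blast)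
  have "inj_mat B t k"
    unfolding inj_mat_def using B lin_depI[OF B] li cols bs by metis
  moreover have "W = (\<lambda>c. B *\<^sub>v c) ` carrier_vec k"
    using col_space_eq[OF B] B cols bs sp unfolding col_space_def by (auto simp: image_iff)
  ultimately show ?thesis by (rule that)
qed

lemma subspace_of_dim_carrier: "subspace_of_dim W t k \<Longrightarrow> x \<in> W \<Longrightarrow> x \<in> carrier_vec t"
  by (auto elim!: range_if_subspace_of_dim simp: inj_mat_def)

section \<open>Singular members of matrix pencils\<close>

text \<open>
  The pencil spanned by \<open>A\<close> and \<open>B\<close> is the family of matrices \<open>s A - r B\<close>; a solution says that
  the member with the projective parameter \<open>(s : r)\<close> has \<open>v\<close> in its kernel. Writing the equation
  with two sides avoids signs.
\<close>

definition degenerate_pencils :: "'a::field itself \<Rightarrow> nat \<Rightarrow> nat \<Rightarrow> bool" where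
  "degenerate_pencils _ m n \<longleftrightarrow>
     (\<forall>(A::'a mat) \<in> carrier_mat m n. \<forall>B \<in> carrier_mat m n.
        \<exists>s r v. (s \<noteq> 0 \<or> r \<noteq> 0) \<and> v \<in> carrier_vec n \<and> v \<noteq> 0\<^sub>v n \<and>
          s \<cdot>\<^sub>v (A *\<^sub>v v) = r \<cdot>\<^sub>v (B *\<^sub>v v))"

text \<open>
  Zero rows make \<open>A\<close> square without changing its kernel, and a square matrix with a zero row is
  singular.
\<close>

lemma wide_mat_kernel:
  fixes A :: "'a::field mat"
  assumes A: "A \<in> carrier_mat m n" and mn: "m < n"
  obtains v where "v \<in> carrier_vec n" "v \<noteq> 0\<^sub>v n" "A *\<^sub>v v = 0\<^sub>v m"
proof -
  define A' where "A' = A @\<^sub>r 0\<^sub>m (n - m) n"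
  have A': "A' \<in> carrier_mat n n"
    using carrier_append_rows[OF A, of "0\<^sub>m (n - m) n" "n - m"] mn by (simp add: A'_def)
  have split: "A' *\<^sub>v v = (A *\<^sub>v v) @\<^sub>v 0\<^sub>v (n - m)" if "v \<in> carrier_vec n" for v
  proof -
    have "0\<^sub>m (n - m) n *\<^sub>v v = 0\<^sub>v (n - m)" using that by (intro eq_vecI) auto
    then show ?thesis
      using mat_mult_append[OF A _ that, of "0\<^sub>m (n - m) n" "n - m"] by (simp add: A'_def)
  qed
  \<comment> \<open>The last row of the padded matrix is zero, so the last unit vector is in the kernel of the
    transpose.\<close>
  have "(transpose_mat A' *\<^sub>v unit_vec n (n - 1)) = row A' (n - 1)"
    using mult_mat_unit_vec[of "transpose_mat A'" n n "n - 1"] A' mn by simp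
  also have "row A' (n - 1) = 0\<^sub>v n"
    using A A' mn by (intro eq_vecI) (auto simp: A'_def append_rows_def)
  finally have "det (transpose_mat A') = 0"
    using A' mn det_0_iff_vec_prod_zero_field[of "transpose_mat A'" n]
    by (metis diff_less gr_implies_not0 less_one linorder_neqE_nat transpose_carrier_mat
        unit_vec_carrier unit_vec_nonzero)
  then have "det A' = 0" using det_transpose[OF A'] by simp
  then obtain v where v: "v \<in> carrier_vec n" "v \<noteq> 0\<^sub>v n" "A' *\<^sub>v v = 0\<^sub>v n"
    using det_0_iff_vec_prod_zero_field[OF A'] by blast
  have "A *\<^sub>v v = 0\<^sub>v m"
  proof (rule eq_vecI)
    fix i assume "i < dim_vec (0\<^sub>v m :: 'a vec)"
    then have i: "i < m" by simp
    have "(A' *\<^sub>v v) $ i = (A *\<^sub>v v) $ i" using split[OF v(1)] i A by simp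
    then show "(A *\<^sub>v v) $ i = 0\<^sub>v m $ i" using v(3) i mn by simp
  qed (use A in simp)
  with v show ?thesis by (blast intro: that)
qed

lemma degenerate_pencils_wide:
  assumes "m < n"
  shows "degenerate_pencils TYPE('a::field) m n"
  unfolding degenerate_pencils_def
proof (intro ballI)
  fix A B :: "'a mat" assume A: "A \<in> carrier_mat m n" and B: "B \<in> carrier_mat m n"
  obtain v where "v \<in> carrier_vec n" "v \<noteq> 0\<^sub>v n" "A *\<^sub>v v = 0\<^sub>v m"
    using wide_mat_kernel[OF A assms] .
  then show "\<exists>s r v. (s \<noteq> 0 \<or> r \<noteq> 0) \<and> v \<in> carrier_vec n \<and> v \<noteq> 0\<^sub>v n \<and>
          s \<cdot>\<^sub>v (A *\<^sub>v v) = r \<cdot>\<^sub>v (B *\<^sub>v v)"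
    using B by (intro exI[of _ 1] exI[of _ 0] exI[of _ v]) auto
qed

text \<open>
  Either \<open>A\<close> itself is singular, or it has an inverse \<open>C\<close> and an eigenvector of \<open>C * B\<close> with
  eigenvalue \<open>k\<close> satisfies \<open>k A v = B v\<close>. The eigenvalue is a root of the characteristic polynomial,
  the only place where the field matters.
\<close>

lemma degenerate_pencils_square:
  assumes root: "\<And>p :: 'a::field poly. degree p = n \<Longrightarrow> lead_coeff p = 1 \<Longrightarrow> \<exists>z. poly p z = 0"
  shows "degenerate_pencils TYPE('a) n n"
  unfolding degenerate_pencils_def
proof (intro ballI)
  fix A B :: "'a mat" assume A: "A \<in> carrier_mat n n" and B: "B \<in> carrier_mat n n"
  show "\<exists>s r v. (s \<noteq> 0 \<or> r \<noteq> 0) \<and> v \<in> carrier_vec n \<and> v \<noteq> 0\<^sub>v n \<and>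
          s \<cdot>\<^sub>v (A *\<^sub>v v) = r \<cdot>\<^sub>v (B *\<^sub>v v)"
  proof (cases "det A = 0")
    case True
    then obtain v where "v \<in> carrier_vec n" "v \<noteq> 0\<^sub>v n" "A *\<^sub>v v = 0\<^sub>v n"
      using det_0_iff_vec_prod_zero_field[OF A] by blast
    then show ?thesis using B by (intro exI[of _ 1] exI[of _ 0] exI[of _ v]) auto
  next
    case False
    from det_non_zero_imp_unit[OF A this, of "()"]
    obtain C where C: "C \<in> carrier_mat n n" and AC: "A * C = 1\<^sub>m n"
      by (auto simp: Units_def ring_mat_simps)
    have CB: "C * B \<in> carrier_mat n n" using C B by simp
    obtain k where "poly (char_poly (C * B)) k = 0"
      using root degree_monic_char_poly[OF CB] by metis
    then obtain v where v: "v \<in> carrier_vec n" "v \<noteq> 0\<^sub>v n" and ev: "(C * B) *\<^sub>v v = k \<cdot>\<^sub>v v"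
      using eigenvalue_root_char_poly[OF CB] C by (auto simp: eigenvalue_def eigenvector_def)
    have "B *\<^sub>v v = (A * C) *\<^sub>v (B *\<^sub>v v)" using AC B v by simp
    also have "\<dots> = A *\<^sub>v ((C * B) *\<^sub>v v)" using A B C v by simp
    also have "\<dots> = k \<cdot>\<^sub>v (A *\<^sub>v v)" unfolding ev using mult_mat_vec[OF A v(1)] .
    finally show ?thesis using v by (intro exI[of _ k] exI[of _ 1] exI[of _ v]) auto
  qed
qed

lemma degenerate_pencils_complex:
  assumes "n \<ge> 1"
  shows "degenerate_pencils TYPE(complex) n n"
proof (rule degenerate_pencils_square)
  fix p :: "complex poly" assume "degree p = n"
  then have "\<not> constant (poly p)" using assms by (simp add: constant_degree)
  then show "\<exists>z. poly p z = 0" by (rule fundamental_theorem_of_algebra)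
qed

text \<open>
  The intermediate value theorem applies, as \<open>p\<close> is positive far to the right and negative far to
  the left. The behaviour on the left is read off from \<open>q\<close>, which is \<open>- p (- x)\<close> and has the
  same leading coefficient because the degree is odd.
\<close>

lemma odd_degree_real_root:
  fixes p :: "real poly"
  assumes "odd (degree p)" "lead_coeff p > 0"
  shows "\<exists>z. poly p z = 0"
proof -
  define q where "q = - (p \<circ>\<^sub>p [:0, -1:])"
  have "lead_coeff q = lead_coeff p"
    using assms(1) lead_coeff_comp[of "[:0, -1:]" p] by (simp add: q_def)
  then obtain b where b: "poly q x > 0" if "x \<ge> b" for x
    using poly_pinfty_gt_lc[of q] assms(2) by (metis less_le_trans)
  obtain a where a: "poly p x > 0" if "x \<ge> a" for x
    using poly_pinfty_gt_lc[of p] assms(2) by (metis less_le_trans)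
  define x where "x = max 1 (max a b)"
  have "poly p x > 0" "poly p (- x) < 0" "- x < x"
    using a[of x] b[of x] by (auto simp: x_def q_def poly_pcompose)
  then show ?thesis using poly_IVT_pos by blast
qed

lemma degenerate_pencils_real_odd:
  assumes "odd n"
  shows "degenerate_pencils TYPE(real) n n"
  by (rule degenerate_pencils_square) (use assms odd_degree_real_root in auto)

text \<open>
  With \<open>J\<close> as multiplication by the imaginary unit on a complex space of half the dimension,
  \<open>s v = r J v\<close> gives \<open>s\<^sup>2 v = s r J v = r\<^sup>2 J (J v) = - r\<^sup>2 v\<close>, hence \<open>(s\<^sup>2 + r\<^sup>2) v = 0\<close>.
\<close>

lemma degenerate_pencils_real_even:
  assumes "even n"
  shows "\<not> degenerate_pencils TYPE(real) n n"
proof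
  obtain k where n: "n = k + k" using assms by (metis dvd_def mult_2)
  define J :: "real mat" where "J = four_block_mat (0\<^sub>m k k) (- 1\<^sub>m k) (1\<^sub>m k) (0\<^sub>m k k)"
  have J: "J \<in> carrier_mat n n" by (simp add: J_def n)
  have "J * J = four_block_mat (- 1\<^sub>m k) (0\<^sub>m k k) (0\<^sub>m k k) (- 1\<^sub>m k)"
    unfolding J_def
    by (subst mult_four_block_mat[of _ k k _ k _ k _ _ k _ k]) auto
  also have "\<dots> = - four_block_mat (1\<^sub>m k) (0\<^sub>m k k) (0\<^sub>m k k) (1\<^sub>m k)"
    by (intro eq_matI) auto
  finally have JJ: "J * J = - 1\<^sub>m n" by (simp add: n)
  assume "degenerate_pencils TYPE(real) n n"
  then obtain s r v where sr: "s \<noteq> 0 \<or> r \<noteq> 0" and v: "v \<in> carrier_vec n" "v \<noteq> 0\<^sub>v n"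
    and eq: "s \<cdot>\<^sub>v (1\<^sub>m n *\<^sub>v v) = r \<cdot>\<^sub>v (J *\<^sub>v v)"
    using J unfolding degenerate_pencils_def by (meson one_carrier_mat)
  have eq: "s \<cdot>\<^sub>v v = r \<cdot>\<^sub>v (J *\<^sub>v v)" using eq v by simp
  have JJv: "J *\<^sub>v (J *\<^sub>v v) = - v"
  proof -
    have "J *\<^sub>v (J *\<^sub>v v) = (J * J) *\<^sub>v v" using J v by simp
    then show ?thesis using v by (simp add: JJ)
  qed
  have "(s * s) \<cdot>\<^sub>v v = s \<cdot>\<^sub>v (r \<cdot>\<^sub>v (J *\<^sub>v v))" by (simp add: eq flip: smult_smult_assoc)
  also have "\<dots> = r \<cdot>\<^sub>v (J *\<^sub>v (s \<cdot>\<^sub>v v))"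
    using mult_mat_vec[OF J v(1)] by (simp add: smult_smult_assoc mult.commute)
  also have "\<dots> = r \<cdot>\<^sub>v (r \<cdot>\<^sub>v (J *\<^sub>v (J *\<^sub>v v)))"
    using mult_mat_vec[OF J, of "J *\<^sub>v v"] J v by (simp add: eq)
  finally have e: "(s * s) \<cdot>\<^sub>v v = (r * r) \<cdot>\<^sub>v (- v)" by (simp add: JJv smult_smult_assoc)
  have "v $ i = 0" if "i < n" for i
  proof -
    have "(s * s + r * r) * v $ i = 0"
      using arg_cong[OF e, of "\<lambda>w. w $ i"] that v by (simp add: algebra_simps)
    moreover have "s * s + r * r \<noteq> 0" using sr by simp
    ultimately show ?thesis by (metis mult_eq_0_iff)
  qed
  then have "v = 0\<^sub>v n" using v by (intro eq_vecI) auto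
  with v show False by simp
qed

section \<open>Inner products given by an involution of the field\<close>

text \<open>
  The identity gives the bilinear product over any field, conjugation the Hermitian product over the
  complex numbers. Either way \<open>form x (k z)\<close> is \<open>\<sigma> k\<close> times \<open>form x z\<close>, so that coefficients of vectors
  in the second argument have to be passed through \<open>\<sigma>\<close>.
\<close>

locale field_involution = field_hom \<sigma> for \<sigma> :: "'a::field \<Rightarrow> 'a" +
  assumes involutive [simp]: "\<sigma> (\<sigma> a) = a"
begin

definition form :: "'a vec \<Rightarrow> 'a vec \<Rightarrow> 'a" where
  "form x y = x \<bullet> map_vec \<sigma> y"

lemma form_commute:
  assumes "x \<in> carrier_vec t" "y \<in> carrier_vec t"
  shows "form y x = \<sigma> (form x y)"
  using assms by (simp add: form_def scalar_prod_def hom_sum hom_mult mult.commute)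

lemma form_eq_0_commute:
  assumes "x \<in> carrier_vec t" "y \<in> carrier_vec t"
  shows "form y x = 0 \<longleftrightarrow> form x y = 0"
  using form_commute[OF assms] by simp

text \<open>
  The arcs run in both directions between the sides, but orthogonality is symmetric, so each edge
  amounts to a single condition.
\<close>

lemma K2_choosable_iff:
  "K2_choosable form m n \<longleftrightarrow>
    (\<forall>t X Y Z. subspace_of_dim X t n \<longrightarrow> subspace_of_dim Y t 2 \<longrightarrow>
      (\<forall>j<m. subspace_of_dim (Z j) t 2) \<longrightarrow>
      (\<exists>x\<in>X. \<exists>y\<in>Y. x \<noteq> 0\<^sub>v t \<and> y \<noteq> 0\<^sub>v t \<and>
        (\<forall>j<m. \<exists>z\<in>Z j. z \<noteq> 0\<^sub>v t \<and> form x z = 0 \<and> form y z = 0)))"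
    (is "_ \<longleftrightarrow> ?R")
proof
  assume L: "K2_choosable form m n"
  show ?R
  proof (intro allI impI)
    fix t :: nat and X Y :: "'a vec set" and Z :: "nat \<Rightarrow> 'a vec set"
    assume X: "subspace_of_dim X t n" and Y: "subspace_of_dim Y t 2"
      and Z: "\<forall>j<m. subspace_of_dim (Z j) t 2"
    define W :: "nat + nat \<Rightarrow> 'a vec set" where "W = case_sum (\<lambda>i. if i = 0 then X else Y) Z"
    have "\<forall>v \<in> pverts (K2 m). subspace_of_dim (W v) t (K2_dims n v)"
      using X Y Z by (auto simp: K2_def K2_dims_def W_def less_2_cases_iff)
    then have "\<exists>w. (\<forall>v \<in> pverts (K2 m). w v \<in> W v \<and> w v \<noteq> 0\<^sub>v t) \<and>
        (\<forall>v v'. (v, v') \<in> parcs (K2 m) \<longrightarrow> form (w v) (w v') = 0)"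
      by (rule L[unfolded K2_choosable_def subspace_choosable_def, folded subspace_of_dim_def,
            THEN spec, THEN spec, THEN mp])
    then obtain w where w: "\<forall>v \<in> pverts (K2 m). w v \<in> W v \<and> w v \<noteq> 0\<^sub>v t"
      and o: "\<forall>v v'. (v, v') \<in> parcs (K2 m) \<longrightarrow> form (w v) (w v') = 0"
      by blast
    have "w (Inl 0) \<in> X" "w (Inl 1) \<in> Y" "w (Inl 0) \<noteq> 0\<^sub>v t" "w (Inl 1) \<noteq> 0\<^sub>v t"
      using w by (force simp: K2_def W_def)+
    moreover have "w (Inr j) \<in> Z j" "w (Inr j) \<noteq> 0\<^sub>v t"
      "form (w (Inl 0)) (w (Inr j)) = 0" "form (w (Inl 1)) (w (Inr j)) = 0" if "j < m" for j
      using w o that by (force simp: K2_def W_def)+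
    ultimately show "\<exists>x\<in>X. \<exists>y\<in>Y. x \<noteq> 0\<^sub>v t \<and> y \<noteq> 0\<^sub>v t \<and>
        (\<forall>j<m. \<exists>z\<in>Z j. z \<noteq> 0\<^sub>v t \<and> form x z = 0 \<and> form y z = 0)" by meson
  qed
next
  assume R: ?R
  show "K2_choosable form m n"
    unfolding K2_choosable_def subspace_choosable_def
  proof (intro allI impI)
    fix t :: nat and W :: "nat + nat \<Rightarrow> 'a vec set"
    assume "\<forall>v \<in> pverts (K2 m).
      VectorSpace.subspace class_ring (W v) (module_vec TYPE('a) t) \<and>
      vectorspace.dim class_ring ((module_vec TYPE('a) t)\<lparr>carrier := W v\<rparr>) = K2_dims n v"
    then have W: "subspace_of_dim (W v) t (K2_dims n v)" if "v \<in> pverts (K2 m)" for v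
      using that unfolding subspace_of_dim_def by blast
    have WX: "subspace_of_dim (W (Inl 0)) t n" and WY: "subspace_of_dim (W (Inl 1)) t 2"
      and WZ: "\<forall>j<m. subspace_of_dim (W (Inr j)) t 2"
      using W[of "Inl 0"] W[of "Inl 1"] W[of "Inr _"] by (auto simp: K2_def K2_dims_def)
    then obtain x y where x: "x \<in> W (Inl 0)" "x \<noteq> 0\<^sub>v t" and y: "y \<in> W (Inl 1)" "y \<noteq> 0\<^sub>v t"
      and "\<forall>j<m. \<exists>z\<in>W (Inr j). z \<noteq> 0\<^sub>v t \<and> form x z = 0 \<and> form y z = 0"
      using R[rule_format, of "W (Inl 0)" t "W (Inl 1)" "\<lambda>j. W (Inr j)"] by auto
    then obtain z where z: "\<And>j. j < m \<Longrightarrow> z j \<in> W (Inr j) \<and> z j \<noteq> 0\<^sub>v t \<and> form x (z j) = 0 \<and> form y (z j) = 0"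
      by metis
    have z': "form (z j) x = 0" "form (z j) y = 0" if "j < m" for j
      using z[OF that] WX WY WZ that x y form_eq_0_commute subspace_of_dim_carrier by metis+
    show "\<exists>w. (\<forall>v \<in> pverts (K2 m). w v \<in> W v \<and> w v \<noteq> 0\<^sub>v t) \<and>
      (\<forall>v v'. (v, v') \<in> parcs (K2 m) \<longrightarrow> form (w v) (w v') = 0)"
      using x y z z'
      by (intro exI[of _ "case_sum (\<lambda>i. if i = 0 then x else y) z"])
        (auto simp: K2_def less_2_cases_iff)
  qed
qed

lemma form_mult_mat_right:
  assumes "x \<in> carrier_vec t" "B \<in> carrier_mat t k" "c \<in> carrier_vec k"
  shows "form x (B *\<^sub>v c) = (transpose_mat (map_mat \<sigma> B) *\<^sub>v x) \<bullet> map_vec \<sigma> c"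
  using assms transpose_vec_mult_scalar[of "map_mat \<sigma> B" t k "map_vec \<sigma> c" x]
  by (simp add: form_def mult_mat_vec_hom)

lemma form_mult_mat_left:
  assumes "B \<in> carrier_mat t k" "c \<in> carrier_vec k" "y \<in> carrier_vec t"
  shows "form (B *\<^sub>v c) y = (transpose_mat B *\<^sub>v map_vec \<sigma> y) \<bullet> c"
  using assms transpose_vec_mult_scalar[of B t k c "map_vec \<sigma> y"]
  by (simp add: form_def comm_scalar_prod[of "B *\<^sub>v c" t])

end

section \<open>Choosability as a property of pencils\<close>

lemma mult_mat_vec_2:
  fixes B :: "'a::comm_semiring_1 mat"
  assumes "B \<in> carrier_mat t 2"
  shows "B *\<^sub>v vec_of_list [a, b] = a \<cdot>\<^sub>v col B 0 + b \<cdot>\<^sub>v col B 1"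
  using assms by (intro eq_vecI) (auto simp: scalar_prod_def numeral_2_eq_2 mult.commute vec_of_list_index)

text \<open>
  The next two facts together say that a two by two matrix has a nontrivial kernel if and only if its
  determinant vanishes. With the rows coming from \<open>x\<close> and \<open>y\<close>, the kernel vector holds the
  coefficients of a vector orthogonal to both of them.
\<close>

lemma common_kernel_2:
  fixes p q p' q' :: "'a::field"
  assumes "p * q' = q * p'"
  obtains a b where "a \<noteq> 0 \<or> b \<noteq> 0" "p * a + q * b = 0" "p' * a + q' * b = 0"
proof (cases "p = 0 \<and> q = 0")
  case False
  show ?thesis using False assms by (intro that[of q "- p"]) (auto simp: algebra_simps)
next
  case True
  show ?thesis
  proof (cases "p' = 0 \<and> q' = 0")
    case False
    then show ?thesis using True by (intro that[of q' "- p'"]) (auto simp: algebra_simps)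
  next
    case nz: True
    then show ?thesis using True by (intro that[of 1 0]) auto
  qed
qed

lemma proportional_if_common_kernel_2:
  fixes p q p' q' :: "'a::field"
  assumes "a \<noteq> 0 \<or> b \<noteq> 0" "p * a + q * b = 0" "p' * a + q' * b = 0"
  shows "p * q' = q * p'"
proof -
  have "a * (p * q' - q * p') = q' * (p * a + q * b) - q * (p' * a + q' * b)"
    and "b * (p * q' - q * p') = p * (p' * a + q' * b) - p' * (p * a + q * b)"
    by (simp_all add: algebra_simps)
  with assms show ?thesis by auto
qed

context field_involution
begin

text \<open>
  Below, \<open>v\<close> is the coordinate vector of \<open>x\<close>, and \<open>y = s d + r e\<close> for the basis \<open>d\<close>, \<open>e\<close> of \<open>Y\<close>. The rows of
  \<open>A\<close> and \<open>B\<close> are read off from the determinant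
  \<open>form x (a j) * form y (b j) - form x (b j) * form y (a j)\<close>: its coefficient of \<open>s\<close> is entry \<open>j\<close> of
  \<open>A v\<close>, and its coefficient of \<open>r\<close> is entry \<open>j\<close> of \<open>- B v\<close>.
\<close>

lemma K2_choosable_if_degenerate_pencils:
  assumes deg: "degenerate_pencils TYPE('a) m n"
  shows "K2_choosable form m n"
  unfolding K2_choosable_iff
proof (intro allI impI)
  fix t :: nat and X Y :: "'a vec set" and Z :: "nat \<Rightarrow> 'a vec set"
  assume X: "subspace_of_dim X t n" and Y: "subspace_of_dim Y t 2"
    and Z: "\<forall>j<m. subspace_of_dim (Z j) t 2"
  obtain P where P: "inj_mat P t n" "X = (\<lambda>c. P *\<^sub>v c) ` carrier_vec n"
    using range_if_subspace_of_dim[OF X] .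
  obtain Q where Q: "inj_mat Q t 2" "Y = (\<lambda>c. Q *\<^sub>v c) ` carrier_vec 2"
    using range_if_subspace_of_dim[OF Y] .
  have "\<forall>j<m. \<exists>R. inj_mat R t 2 \<and> Z j = (\<lambda>c. R *\<^sub>v c) ` carrier_vec 2"
    using range_if_subspace_of_dim Z by metis
  then obtain R where R: "\<And>j. j < m \<Longrightarrow> inj_mat (R j) t 2 \<and> Z j = (\<lambda>c. R j *\<^sub>v c) ` carrier_vec 2"
    by metis
  have Pc: "P \<in> carrier_mat t n" and Qc: "Q \<in> carrier_mat t 2"
    and Rc: "\<And>j. j < m \<Longrightarrow> R j \<in> carrier_mat t 2"
    using P Q R by (auto simp: inj_mat_def)
  define a where "a j = col (R j) 0" for j
  define b where "b j = col (R j) 1" for j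
  have ab: "a j \<in> carrier_vec t" "b j \<in> carrier_vec t" if "j < m" for j
    using Rc[OF that] by (auto simp: a_def b_def)
  define d where "d = col Q 0"
  define e where "e = col Q 1"
  have de: "d \<in> carrier_vec t" "e \<in> carrier_vec t" using Qc by (auto simp: d_def e_def)
  \<comment> \<open>The vector \<open>g w\<close> represents the linear functional on coordinates of \<open>X\<close> given by the form
    with \<open>w\<close>.\<close>
  define g where "g x = transpose_mat P *\<^sub>v map_vec \<sigma> x" for x
  have g: "g x \<in> carrier_vec n" "v \<in> carrier_vec n \<Longrightarrow> form (P *\<^sub>v v) x = g x \<bullet> v"
    if "x \<in> carrier_vec t" for x v
    using that Pc form_mult_mat_left[OF Pc _ that] by (auto simp: g_def)
  define A where "A = mat_of_rows n (map (\<lambda>j. form d (b j) \<cdot>\<^sub>v g (a j) - form d (a j) \<cdot>\<^sub>v g (b j)) [0..<m])"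
  define B where "B = mat_of_rows n (map (\<lambda>j. form e (a j) \<cdot>\<^sub>v g (b j) - form e (b j) \<cdot>\<^sub>v g (a j)) [0..<m])"
  have A: "A \<in> carrier_mat m n" and B: "B \<in> carrier_mat m n" by (auto simp: A_def B_def)
  obtain s r v where sr: "s \<noteq> 0 \<or> r \<noteq> 0" and v: "v \<in> carrier_vec n" "v \<noteq> 0\<^sub>v n"
    and eq: "s \<cdot>\<^sub>v (A *\<^sub>v v) = r \<cdot>\<^sub>v (B *\<^sub>v v)"
    using deg A B unfolding degenerate_pencils_def by blast
  define x where "x = P *\<^sub>v v"
  define y where "y = Q *\<^sub>v vec_of_list [s, r]"
  have y_eq: "y = s \<cdot>\<^sub>v d + r \<cdot>\<^sub>v e" unfolding y_def d_def e_def by (rule mult_mat_vec_2[OF Qc])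
  have nz2: "vec_of_list [a, b] \<noteq> 0\<^sub>v 2" if "a \<noteq> 0 \<or> b \<noteq> 0" for a b :: 'a
  proof
    assume "vec_of_list [a, b] = 0\<^sub>v 2"
    then have "vec_of_list [a, b] $ i = 0\<^sub>v 2 $ i" for i by simp
    from this[of 0] this[of 1] that show False by auto
  qed
  have c2: "vec_of_list [a, b] \<in> carrier_vec 2" for a b :: 'a
    by (rule carrier_vecI) simp
  have x: "x \<in> X" "x \<noteq> 0\<^sub>v t" "x \<in> carrier_vec t"
    using P v Pc by (auto simp: x_def inj_mat_def)
  have y: "y \<in> Y" "y \<noteq> 0\<^sub>v t" "y \<in> carrier_vec t"
    using Q c2[of s r] nz2[OF sr] Qc by (auto simp: y_def inj_mat_def)
  have "\<exists>z\<in>Z j. z \<noteq> 0\<^sub>v t \<and> form x z = 0 \<and> form y z = 0" if j: "j < m" for j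
  proof -
    have fy: "form y w = s * form d w + r * form e w" if "w \<in> carrier_vec t" for w
      using that de by (simp add: y_eq form_def add_scalar_prod_distrib[of _ t])
    have Av: "(A *\<^sub>v v) $ j = form d (b j) * form x (a j) - form d (a j) * form x (b j)"
      using j A v g[OF ab(1)[OF j]] g[OF ab(2)[OF j]]
      by (simp add: A_def x_def minus_scalar_prod_distrib[of _ n])
    have Bv: "(B *\<^sub>v v) $ j = form e (a j) * form x (b j) - form e (b j) * form x (a j)"
      using j B v g[OF ab(1)[OF j]] g[OF ab(2)[OF j]]
      by (simp add: B_def x_def minus_scalar_prod_distrib[of _ n])
    have "s * (A *\<^sub>v v) $ j = r * (B *\<^sub>v v) $ j"
      using arg_cong[OF eq, of "\<lambda>w. w $ j"] A B v j by simp
    then have "form x (a j) * form y (b j) = form x (b j) * form y (a j)"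
      unfolding Av Bv fy[OF ab(1)[OF j]] fy[OF ab(2)[OF j]] by (simp add: algebra_simps)
    then obtain k l where kl: "k \<noteq> 0 \<or> l \<noteq> 0" "form x (a j) * k + form x (b j) * l = 0"
      "form y (a j) * k + form y (b j) * l = 0"
      by (rule common_kernel_2)
    \<comment> \<open>The form applies \<open>\<sigma>\<close> to the coefficients of its second argument, which turns them back into
      \<open>k\<close> and \<open>l\<close>.\<close>
    define z where "z = R j *\<^sub>v vec_of_list [\<sigma> k, \<sigma> l]"
    have z: "z = \<sigma> k \<cdot>\<^sub>v a j + \<sigma> l \<cdot>\<^sub>v b j"
      unfolding z_def a_def b_def by (rule mult_mat_vec_2[OF Rc[OF j]])
    have fz: "form w z = form w (a j) * k + form w (b j) * l" if w: "w \<in> carrier_vec t" for w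
    proof -
      have "map_vec \<sigma> z = k \<cdot>\<^sub>v map_vec \<sigma> (a j) + l \<cdot>\<^sub>v map_vec \<sigma> (b j)"
        using ab[OF j] unfolding z by (intro eq_vecI) (auto simp: hom_add hom_mult)
      then show ?thesis
        using w ab[OF j] by (simp add: form_def scalar_prod_add_distrib[of _ t] mult.commute)
    qed
    have "z \<in> Z j" "z \<noteq> 0\<^sub>v t"
      using R[OF j] c2 nz2[of "\<sigma> k" "\<sigma> l"] kl(1) by (auto simp: z_def inj_mat_def)
    then show ?thesis using kl x y fz by auto
  qed
  then show "\<exists>x\<in>X. \<exists>y\<in>Y. x \<noteq> 0\<^sub>v t \<and> y \<noteq> 0\<^sub>v t \<and>
      (\<forall>j<m. \<exists>z\<in>Z j. z \<noteq> 0\<^sub>v t \<and> form x z = 0 \<and> form y z = 0)"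
    using x y by blast
qed

text \<open>
  Given the pencil, \<open>P\<close> and \<open>Q\<close> below embed the first \<open>n\<close> and the last two coordinates of the
  \<open>(n + 2)\<close>-dimensional space, and the range of \<open>R j\<close> is spanned by row \<open>j\<close> of \<open>A\<close> and of \<open>B\<close> (with \<open>\<sigma>\<close>
  applied), each extended by one of the last two unit vectors. These unit vectors make \<open>R j\<close>
  injective whatever the rows are. If \<open>x = (v, 0)\<close> and \<open>y = (0, w)\<close> are both orthogonal to a
  nonzero vector of this plane, then \<open>((A v) j, (B v) j)\<close> and \<open>w\<close> are proportional, with a factor
  that may depend on \<open>j\<close>. Taking \<open>(s, r) = (w 1, w 0)\<close> removes that factor.
\<close>

lemma degenerate_pencils_if_K2_choosable:
  assumes ch: "K2_choosable form m n"
  shows "degenerate_pencils TYPE('a) m n"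
  unfolding degenerate_pencils_def
proof (intro ballI)
  fix A B :: "'a mat" assume A: "A \<in> carrier_mat m n" and B: "B \<in> carrier_mat m n"
  define t where "t = n + 2"
  define P where "P = 1\<^sub>m n @\<^sub>r (0\<^sub>m 2 n :: 'a mat)"
  define Q where "Q = 0\<^sub>m n 2 @\<^sub>r (1\<^sub>m 2 :: 'a mat)"
  define G where "G j = mat_of_cols n [map_vec \<sigma> (row A j), map_vec \<sigma> (row B j)]" for j
  define R where "R j = G j @\<^sub>r (1\<^sub>m 2 :: 'a mat)" for j
  have Gc: "G j \<in> carrier_mat n 2" for j
    using mat_of_cols_carrier(1)[of n "[map_vec \<sigma> (row A j), map_vec \<sigma> (row B j)]"]
    by (simp add: G_def numeral_2_eq_2)
  have Pv: "P *\<^sub>v v = v @\<^sub>v 0\<^sub>v 2" if "v \<in> carrier_vec n" for v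
  proof -
    have "0\<^sub>m 2 n *\<^sub>v v = 0\<^sub>v 2" using that by (intro eq_vecI) auto
    then show ?thesis using that by (simp add: P_def mat_mult_append[of _ n n _ 2])
  qed
  have Qv: "Q *\<^sub>v v = 0\<^sub>v n @\<^sub>v v" if "v \<in> carrier_vec 2" for v
  proof -
    have "0\<^sub>m n 2 *\<^sub>v v = 0\<^sub>v n" using that by (intro eq_vecI) auto
    then show ?thesis using that by (simp add: Q_def mat_mult_append[of _ n 2 _ 2])
  qed
  have Rv: "R j *\<^sub>v c = (G j *\<^sub>v c) @\<^sub>v c" if "c \<in> carrier_vec 2" for j c
    using that Gc[of j] by (simp add: R_def mat_mult_append[of _ n 2 _ 2])
  have zero: "0\<^sub>v t = 0\<^sub>v n @\<^sub>v (0\<^sub>v 2 :: 'a vec)" by (auto simp: t_def)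
  have Pc: "P \<in> carrier_mat t n" and Qc: "Q \<in> carrier_mat t 2" and Rc: "R j \<in> carrier_mat t 2" for j
    unfolding P_def Q_def R_def t_def using Gc[of j] by (intro carrier_append_rows; simp)+
  have Pi: "inj_mat P t n" and Qi: "inj_mat Q t 2" and Ri: "inj_mat (R j) t 2" for j
  proof -
    show "inj_mat P t n" unfolding inj_mat_def
    proof (intro conjI ballI impI Pc)
      fix c :: "'a vec" assume c: "c \<in> carrier_vec n" and e: "P *\<^sub>v c = 0\<^sub>v t"
      have "c @\<^sub>v 0\<^sub>v 2 = 0\<^sub>v n @\<^sub>v (0\<^sub>v 2 :: 'a vec)" using e unfolding Pv[OF c] zero .
      then show "c = 0\<^sub>v n" using append_vec_eq[OF c, of "0\<^sub>v n"] by simp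
    qed
    show "inj_mat Q t 2" unfolding inj_mat_def
    proof (intro conjI ballI impI Qc)
      fix c :: "'a vec" assume c: "c \<in> carrier_vec 2" and e: "Q *\<^sub>v c = 0\<^sub>v t"
      have "0\<^sub>v n @\<^sub>v c = 0\<^sub>v n @\<^sub>v (0\<^sub>v 2 :: 'a vec)" using e unfolding Qv[OF c] zero .
      then show "c = 0\<^sub>v 2" using append_vec_eq[of "0\<^sub>v n :: 'a vec" n "0\<^sub>v n"] by simp
    qed
    show "inj_mat (R j) t 2" unfolding inj_mat_def
    proof (intro conjI ballI impI Rc)
      fix c :: "'a vec" assume c: "c \<in> carrier_vec 2" and e: "R j *\<^sub>v c = 0\<^sub>v t"
      have "(G j *\<^sub>v c) @\<^sub>v c = 0\<^sub>v n @\<^sub>v (0\<^sub>v 2 :: 'a vec)" using e unfolding Rv[OF c] zero .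
      then show "c = 0\<^sub>v 2"
        using append_vec_eq[of "G j *\<^sub>v c" n "0\<^sub>v n"] Gc[of j] c by simp
    qed
  qed
  have "\<exists>x \<in> (\<lambda>c. P *\<^sub>v c) ` carrier_vec n. \<exists>y \<in> (\<lambda>c. Q *\<^sub>v c) ` carrier_vec 2.
      x \<noteq> 0\<^sub>v t \<and> y \<noteq> 0\<^sub>v t \<and>
      (\<forall>j<m. \<exists>z \<in> (\<lambda>c. R j *\<^sub>v c) ` carrier_vec 2. z \<noteq> 0\<^sub>v t \<and> form x z = 0 \<and> form y z = 0)"
    using iffD1[OF K2_choosable_iff ch, THEN spec, THEN spec, THEN spec, THEN spec,
        THEN mp, OF subspace_of_dim_range[OF Pi], THEN mp, OF subspace_of_dim_range[OF Qi],
        of "\<lambda>j. (\<lambda>c. R j *\<^sub>v c) ` carrier_vec 2"] subspace_of_dim_range[OF Ri]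
    by simp
  then obtain x y where x: "x \<in> (\<lambda>c. P *\<^sub>v c) ` carrier_vec n" "x \<noteq> 0\<^sub>v t"
    and y: "y \<in> (\<lambda>c. Q *\<^sub>v c) ` carrier_vec 2" "y \<noteq> 0\<^sub>v t"
    and z: "\<And>j. j < m \<Longrightarrow> \<exists>z \<in> (\<lambda>c. R j *\<^sub>v c) ` carrier_vec 2. z \<noteq> 0\<^sub>v t \<and> form x z = 0 \<and> form y z = 0"
    by meson
  obtain v where v: "v \<in> carrier_vec n" and xv: "x = v @\<^sub>v 0\<^sub>v 2" using x Pv by auto
  obtain w where w: "w \<in> carrier_vec 2" and yw: "y = 0\<^sub>v n @\<^sub>v w" using y Qv by auto
  have vnz: "v \<noteq> 0\<^sub>v n" using x(2) by (auto simp: xv zero)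
  have wnz: "w \<noteq> 0\<^sub>v 2" using y(2) by (auto simp: yw zero)
  have eq: "w $ 1 * (A *\<^sub>v v) $ j = w $ 0 * (B *\<^sub>v v) $ j" if j: "j < m" for j
  proof -
    obtain c where c: "c \<in> carrier_vec 2" and cnz: "R j *\<^sub>v c \<noteq> 0\<^sub>v t"
      and fx: "form x (R j *\<^sub>v c) = 0" and fy: "form y (R j *\<^sub>v c) = 0"
      using z[OF j] by blast
    have cnz: "c \<noteq> 0\<^sub>v 2" using cnz Gc[of j] by (auto simp: Rv zero)
    have G\<sigma>: "transpose_mat (map_mat \<sigma> (G j)) *\<^sub>v v = vec_of_list [(A *\<^sub>v v) $ j, (B *\<^sub>v v) $ j]"
      (is "?l = ?r")
    proof (rule eq_vecI)
      fix i assume "i < dim_vec ?r"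
      then consider "i = 0" | "i = 1" by fastforce
      then show "?l $ i = ?r $ i"
      proof cases
        case 1
        have "col (map_mat \<sigma> (G j)) 0 = row A j"
          using A j by (intro eq_vecI) (auto simp: G_def mat_of_cols_index)
        then show ?thesis using 1 A j Gc[of j] by simp
      next
        case 2
        have "col (map_mat \<sigma> (G j)) 1 = row B j"
          using B j by (intro eq_vecI) (auto simp: G_def mat_of_cols_index)
        then show ?thesis using 2 B j Gc[of j] by simp
      qed
    qed (use Gc[of j] in auto)
    have "map_vec \<sigma> (R j *\<^sub>v c) = map_vec \<sigma> (G j *\<^sub>v c) @\<^sub>v map_vec \<sigma> c"
      using c Gc[of j] by (intro eq_vecI) (auto simp: Rv)
    then have "form x (R j *\<^sub>v c) = form v (G j *\<^sub>v c)" "form y (R j *\<^sub>v c) = form w c"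
      using c v w Gc[of j] by (simp_all add: form_def xv yw scalar_prod_append[of _ n _ 2])
    then have "(A *\<^sub>v v) $ j * \<sigma> (c $ 0) + (B *\<^sub>v v) $ j * \<sigma> (c $ 1) = 0"
      "w $ 0 * \<sigma> (c $ 0) + w $ 1 * \<sigma> (c $ 1) = 0"
      using fx fy c form_mult_mat_right[OF v Gc[of j] c]
      by (simp_all add: G\<sigma> form_def scalar_prod_def numeral_2_eq_2)
    moreover have "\<sigma> (c $ 0) \<noteq> 0 \<or> \<sigma> (c $ 1) \<noteq> 0"
      using cnz c by (auto simp: vec_eq_iff less_2_cases_iff)
    ultimately have "(A *\<^sub>v v) $ j * w $ 1 = (B *\<^sub>v v) $ j * w $ 0"
      using proportional_if_common_kernel_2 by blast
    then show ?thesis by (simp add: mult.commute)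
  qed
  have "w $ 1 \<cdot>\<^sub>v (A *\<^sub>v v) = w $ 0 \<cdot>\<^sub>v (B *\<^sub>v v)"
    using A B eq by (intro eq_vecI) auto
  moreover have "w $ 1 \<noteq> 0 \<or> w $ 0 \<noteq> 0"
    using wnz w by (auto simp: vec_eq_iff less_2_cases_iff)
  ultimately show "\<exists>s r v. (s \<noteq> 0 \<or> r \<noteq> 0) \<and> v \<in> carrier_vec n \<and> v \<noteq> 0\<^sub>v n \<and>
          s \<cdot>\<^sub>v (A *\<^sub>v v) = r \<cdot>\<^sub>v (B *\<^sub>v v)"
    using v vnz by blast
qed

theorem K2_choosable_iff_degenerate_pencils:
  "K2_choosable form m n \<longleftrightarrow> degenerate_pencils TYPE('a) m n"
  using K2_choosable_if_degenerate_pencils degenerate_pencils_if_K2_choosable by blast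

end

section \<open>The bilinear and the Hermitian inner product\<close>

lemma K2_choosable_scalar_prod_iff:
  "K2_choosable (scalar_prod :: 'a::field vec \<Rightarrow> 'a vec \<Rightarrow> 'a) m n \<longleftrightarrow> degenerate_pencils TYPE('a) m n"
proof -
  have id: "map_vec (\<lambda>a. a) y = y" for y :: "'a vec" by auto
  interpret field_involution "\<lambda>a :: 'a. a" by unfold_locales (rule refl)+
  have "form = scalar_prod" unfolding form_def[abs_def] id ..
  then show ?thesis using K2_choosable_iff_degenerate_pencils by metis
qed

lemma K2_choosable_cscalar_prod_iff:
  "K2_choosable (cscalar_prod :: complex vec \<Rightarrow> complex vec \<Rightarrow> complex) m n \<longleftrightarrow>
    degenerate_pencils TYPE(complex) m n"
proof -
  interpret field_involution cnj by unfold_locales auto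
  have "form = cscalar_prod" by (intro ext) (simp add: form_def map_vec_def conjugate_vec_def)
  then show ?thesis using K2_choosable_iff_degenerate_pencils by metis
qed

theorem theorem1p7:
  fixes n :: nat
  assumes "n \<ge> 1"
  shows "(K2_choosable (scalar_prod :: 'a::field vec \<Rightarrow> 'a vec \<Rightarrow> 'a) (n - 1) n \<and>
          K2_choosable (cscalar_prod :: complex vec \<Rightarrow> complex vec \<Rightarrow> complex) (n - 1) n) \<and>
         K2_choosable (cscalar_prod :: complex vec \<Rightarrow> complex vec \<Rightarrow> complex) n n \<and>
         (K2_choosable (scalar_prod :: real vec \<Rightarrow> real vec \<Rightarrow> real) n n \<longleftrightarrow> odd n)"
proof -
  have "n - 1 < n" using assms by simp
  note wide = degenerate_pencils_wide[OF this]
  have real: "degenerate_pencils TYPE(real) n n \<longleftrightarrow> odd n"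
    using degenerate_pencils_real_odd degenerate_pencils_real_even by metis
  show ?thesis
    unfolding K2_choosable_scalar_prod_iff K2_choosable_cscalar_prod_iff
    by (intro conjI wide degenerate_pencils_complex assms real)
qed

end
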